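(* Let $K$ be a field, let $n_1<n_2<n_3<n_4$ be positive integers with $\gcd(n_1,n_2,n_3,n_4)=1$, and let $C$ be the monomial curve $x_i=t^{n_i}$ ($1\le i\le 4$) in $\mathbb{A}^4(K)$. Assume that $C$ is Gorenstein and not a complete intersection, that $C$ has Cohen-Macaulay tangent cone at the origin, and that $I(C)$ is minimally generated by $$f_1=x_1^{a_1}-x_2^{a_{12}}x_4^{a_{14}},\quad f_2=x_2^{a_2}-x_3^{a_{23}}x_4^{a_{24}},\quad f_3=x_3^{a_3}-x_1^{a_{31}}x_2^{a_{32}},$$ $$f_4=x_4^{a_4}-x_1^{a_{41}}x_3^{a_{43}},\quad f_5=x_1^{a_{31}}x_4^{a_{24}}-x_2^{a_{12}}x_3^{a_{43}},$$ where $a_i>1$ and $0<a_{ij}<a_j$ for all the exponents appearing. Suppose that $a_{23}<a_{43}$ and $a_{14}\le a_{24}$. If $a_3\le a_{31}+a_{32}$, $a_{12}+a_{43}\le a_{31}+a_{24}$ and $a_2+a_{12}\le a_1+a_{23}+a_{24}-a_{14}$, then $I(C)_*$ is minimally generated by the six polynomials $$G_*=\{x_2^{a_{12}}x_4^{a_{14}},\ x_3^{a_{23}}x_4^{a_{24}},\ x_3^{a_3},\ x_4^{a_4},\ p_5,\ p_6\},$$ where $p_5=x_2^{a_{12}}x_3^{a_{43}}$ if $a_{12}+a_{43}<a_{31}+a_{24}$ and $p_5=x_1^{a_{31}}x_4^{a_{24}}-x_2^{a_{12}}x_3^{a_{43}}$ if $a_{12}+a_{43}=a_{31}+a_{24}$;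 $p_6=x_2^{a_2+a_{12}}$ if $a_2+a_{12}<a_1+a_{23}+a_{24}-a_{14}$ and $p_6=x_2^{a_2+a_{12}}-x_1^{a_1}x_3^{a_{23}}x_4^{a_{24}-a_{14}}$ if $a_2+a_{12}=a_1+a_{23}+a_{24}-a_{14}$.
   Context: $I(C)$ is the kernel of the $K$-algebra homomorphism $\phi:K[x_1,\ldots,x_4]\to K[t]$, $\phi(x_i)=t^{n_i}$. $C$ is Gorenstein when the numerical semigroup generated by $n_1,\ldots,n_4$ is symmetric, and it is not a complete intersection when $I(C)$ cannot be generated by three elements. For $0\ne f\in I(C)$, $f_*$ denotes the homogeneous summand of $f$ of least (standard) degree, and $I(C)_*$ is the ideal of $K[x_1,\ldots,x_4]$ generated by all $f_*$, $f\in I(C)$; it is the defining ideal of the tangent cone of $C$ at the origin. $C$ has Cohen-Macaulay tangent cone at the origin if $K[x_1,\ldots,x_4]/I(C)_*$ is Cohen-Macaulay. In the described situation the exponents satisfy (Bresinsky) $a_1=a_{31}+a_{41}$, $a_2=a_{12}+a_{32}$, $a_3=a_{23}+a_{43}$, $a_4=a_{14}+a_{24}$. *)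

theory Defs
  imports
    "HOL-Library.Poly_Mapping"
    "HOL-Library.Numeral_Type"
    "HOL-Library.Extended_Nat"
    "HOL-Computational_Algebra.Polynomial"
    "HOL-Algebra.QuotRing"
    "HOL-Algebra.Ring_Divisibility"
begin

section \<open>Ideals and Cohen-Macaulay rings\<close>

text \<open>
  A list of generators is minimal if no proper subset of it generates the ideal; \<^term>\<open>distinct\<close>
  makes the length of the list the number of generators.
\<close>

definition minimally_generates :: "('a, 'b) ring_scheme \<Rightarrow> 'a list \<Rightarrow> 'a set \<Rightarrow> bool" where
  "minimally_generates R gs I \<longleftrightarrow>
     distinct gs \<and> set gs \<subseteq> carrier R \<and> Idl\<^bsub>R\<^esub> (set gs) = I \<and>
     (\<forall>S. S \<subset> set gs \<longrightarrow> Idl\<^bsub>R\<^esub> S \<noteq> I)"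

definition regular_sequence :: "('a, 'b) ring_scheme \<Rightarrow> 'a list \<Rightarrow> bool" where
  "regular_sequence R rs \<longleftrightarrow>
     set rs \<subseteq> carrier R \<and> Idl\<^bsub>R\<^esub> (set rs) \<noteq> carrier R \<and>
     (\<forall>i < length rs. \<forall>a \<in> carrier R.
        rs ! i \<otimes>\<^bsub>R\<^esub> a \<in> Idl\<^bsub>R\<^esub> (set (take i rs)) \<longrightarrow> a \<in> Idl\<^bsub>R\<^esub> (set (take i rs)))"

definition ideal_depth :: "('a, 'b) ring_scheme \<Rightarrow> 'a set \<Rightarrow> enat" where
  "ideal_depth R I = Sup {enat (length rs) | rs. regular_sequence R rs \<and> set rs \<subseteq> I}"

definition prime_height :: "('a, 'b) ring_scheme \<Rightarrow> 'a set \<Rightarrow> enat" where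
  "prime_height R P =
     Sup {enat k | k. \<exists>Q :: nat \<Rightarrow> 'a set.
       (\<forall>i \<le> k. primeideal (Q i) R) \<and> (\<forall>i < k. Q i \<subset> Q (Suc i)) \<and> Q k = P}"

text \<open>
  This is the localization-free definition (Eisenbud, Section 18.2): depth equals codimension at
  every maximal ideal.
\<close>

definition cohen_macaulay :: "('a, 'b) ring_scheme \<Rightarrow> bool" where
  "cohen_macaulay R \<longleftrightarrow>
     cring R \<and> noetherian_ring R \<and>
     (\<forall>P. maximalideal P R \<longrightarrow> ideal_depth R P = prime_height R P)"

section \<open>Polynomials in four variables\<close>

text \<open>
  A polynomial maps exponent vectors to coefficients.  The variables are indexed by the
  four-element type \<^typ>\<open>4\<close>, whose elements are \<open>1, 2, 3, 4\<close> (note that \<open>4 = 0\<close> there, so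
  this type is only used as a set of labels).
\<close>

type_synonym 'k mpoly4 = "(4 \<Rightarrow>\<^sub>0 nat) \<Rightarrow>\<^sub>0 'k"

definition X :: "4 \<Rightarrow> 'k::field mpoly4" where
  "X i = Poly_Mapping.single (Poly_Mapping.single i 1) 1"

definition mpoly4_ring :: "'k::field mpoly4 ring" where
  "mpoly4_ring = \<lparr>carrier = UNIV, mult = (*), one = 1, zero = 0, add = (+)\<rparr>"

lemma cring_mpoly4_ring: "cring (mpoly4_ring :: 'k::field mpoly4 ring)"
  unfolding mpoly4_ring_def
  by (rule cringI, rule abelian_groupI, auto intro: comm_monoidI simp: algebra_simps)
    (metis add.right_inverse add.commute)

definition total_degree :: "(4 \<Rightarrow>\<^sub>0 nat) \<Rightarrow> nat" where
  "total_degree m = (\<Sum>i\<in>UNIV. Poly_Mapping.lookup m i)"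

definition homogeneous_summand :: "nat \<Rightarrow> 'k::field mpoly4 \<Rightarrow> 'k mpoly4" where
  "homogeneous_summand d f =
     (\<Sum>m\<in>{m \<in> Poly_Mapping.keys f. total_degree m = d}.
        Poly_Mapping.single m (Poly_Mapping.lookup f m))"

text \<open>Only meaningful for nonzero \<open>f\<close>.\<close>

definition initial_form :: "'k::field mpoly4 \<Rightarrow> 'k mpoly4" where
  "initial_form f = homogeneous_summand (LEAST d. homogeneous_summand d f \<noteq> 0) f"

definition initial_ideal :: "'k::field mpoly4 set \<Rightarrow> 'k mpoly4 set" where
  "initial_ideal I = Idl\<^bsub>mpoly4_ring\<^esub> {initial_form f | f. f \<in> I \<and> f \<noteq> 0}"

section \<open>Monomial curves in affine 4-space\<close>

text \<open>The \<open>K\<close>-algebra homomorphism with \<open>X i \<mapsto> t ^ n i\<close>.\<close>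

definition curve_hom :: "(4 \<Rightarrow> nat) \<Rightarrow> 'k::field mpoly4 \<Rightarrow> 'k poly" where
  "curve_hom n f =
     (\<Sum>m\<in>Poly_Mapping.keys f.
        Polynomial.smult (Poly_Mapping.lookup f m)
          (\<Prod>i\<in>UNIV. Polynomial.monom 1 (n i) ^ Poly_Mapping.lookup m i))"

lemma curve_hom_superset:
  assumes "finite A" "Poly_Mapping.keys f \<subseteq> A"
  shows "curve_hom n f =
     (\<Sum>m\<in>A. Polynomial.smult (Poly_Mapping.lookup f m)
          (\<Prod>i\<in>UNIV. Polynomial.monom 1 (n i) ^ Poly_Mapping.lookup m i))"
  unfolding curve_hom_def using assms
  by (intro sum.mono_neutral_left) (auto simp: in_keys_iff)

lemma curve_hom_add: "curve_hom n (f + g) = curve_hom n f + curve_hom n g"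
proof -
  let ?A = "Poly_Mapping.keys f \<union> Poly_Mapping.keys g"
  have "Poly_Mapping.keys (f + g) \<subseteq> ?A" by (rule Poly_Mapping.keys_add)
  then show ?thesis
    by (simp add: curve_hom_superset[of ?A] lookup_add smult_add_left sum.distrib)
qed

lemma curve_hom_single:
  "curve_hom n (Poly_Mapping.single m c) =
     Polynomial.smult c (\<Prod>i\<in>UNIV. Polynomial.monom 1 (n i) ^ Poly_Mapping.lookup m i)"
  by (cases "c = 0") (simp_all add: curve_hom_def)

lemma curve_hom_const: "curve_hom n (Poly_Mapping.single 0 c) = [:c:]"
  by (simp add: curve_hom_single)

lemma curve_hom_X: "curve_hom n (X i) = Polynomial.monom 1 (n i)"
proof -
  have "(\<Prod>j\<in>UNIV. Polynomial.monom 1 (n j) ^ Poly_Mapping.lookup (Poly_Mapping.single i 1) j) =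
    (\<Prod>j\<in>UNIV. if j = i then Polynomial.monom (1 :: 'a) (n i) else 1)"
    by (rule prod.cong) (auto simp: lookup_single when_def)
  then show ?thesis by (simp add: X_def curve_hom_single)
qed

lemma curve_hom_mult: "curve_hom n (f * g) = curve_hom n f * curve_hom n g"
proof -
  have eq: "f = (\<Sum>m\<in>Poly_Mapping.keys f. Poly_Mapping.single m (Poly_Mapping.lookup f m))"
    for f :: "'a mpoly4"
    by (rule poly_mapping_eqI)
      (auto simp: lookup_sum lookup_single when_def in_keys_iff)
  have sum_h: "curve_hom n (sum h A) = (\<Sum>x\<in>A. curve_hom n (h x))"
    if "finite A" for h :: "(4 \<Rightarrow>\<^sub>0 nat) \<Rightarrow> 'a mpoly4" and A
    using that by (induction A) (simp_all add: curve_hom_add, simp add: curve_hom_def)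
  have single: "curve_hom n (Poly_Mapping.single m c * Poly_Mapping.single m' c') =
      curve_hom n (Poly_Mapping.single m c) * curve_hom n (Poly_Mapping.single m' (c' :: 'a))"
    for m m' c c'
    by (simp add: mult_single curve_hom_single lookup_add power_add prod.distrib mult.commute)
  have "curve_hom n (f * g) = curve_hom n
      ((\<Sum>m\<in>Poly_Mapping.keys f. Poly_Mapping.single m (Poly_Mapping.lookup f m)) *
       (\<Sum>m\<in>Poly_Mapping.keys g. Poly_Mapping.single m (Poly_Mapping.lookup g m)))"
    using eq[of f] eq[of g] by simp
  also have "\<dots> =
      curve_hom n (\<Sum>m\<in>Poly_Mapping.keys f. Poly_Mapping.single m (Poly_Mapping.lookup f m)) *
      curve_hom n (\<Sum>m\<in>Poly_Mapping.keys g. Poly_Mapping.single m (Poly_Mapping.lookup g m))"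
    by (simp add: sum_product sum_h single)
  finally show ?thesis using eq[of f] eq[of g] by simp
qed

definition curve_ideal :: "(4 \<Rightarrow> nat) \<Rightarrow> 'k::field mpoly4 set" where
  "curve_ideal n = {f. curve_hom n f = 0}"

definition semigroup_of :: "(4 \<Rightarrow> nat) \<Rightarrow> nat set" where
  "semigroup_of n = {\<Sum>i\<in>UNIV. c i * n i | c. True}"

text \<open>
  \<open>F\<close> is the Frobenius number, the largest integer outside \<open>S\<close>; it is taken in \<^typ>\<open>int\<close> because
  it is \<open>-1\<close> for \<open>S = UNIV\<close>.
\<close>

definition symmetric_semigroup :: "nat set \<Rightarrow> bool" where
  "symmetric_semigroup S \<longleftrightarrow>
     (\<exists>F :: int. F \<notin> int ` S \<and> (\<forall>z > F. z \<in> int ` S) \<and>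
        (\<forall>z. z \<in> int ` S \<longleftrightarrow> F - z \<notin> int ` S))"

definition gorenstein_curve :: "(4 \<Rightarrow> nat) \<Rightarrow> bool" where
  "gorenstein_curve n \<longleftrightarrow> symmetric_semigroup (semigroup_of n)"

text \<open>
  The defining ideal depends on the field, which is therefore passed as a type argument.
\<close>

definition complete_intersection_curve :: "'k::field itself \<Rightarrow> (4 \<Rightarrow> nat) \<Rightarrow> bool" where
  "complete_intersection_curve _ n \<longleftrightarrow>
     (\<exists>f g h. Idl\<^bsub>mpoly4_ring\<^esub> {f, g, h} = (curve_ideal n :: 'k mpoly4 set))"

definition cohen_macaulay_tangent_cone :: "'k::field itself \<Rightarrow> (4 \<Rightarrow> nat) \<Rightarrow> bool" where
  "cohen_macaulay_tangent_cone _ n \<longleftrightarrow>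
     cohen_macaulay (mpoly4_ring Quot initial_ideal (curve_ideal n :: 'k mpoly4 set))"

end

theory Submission
  imports Defs "HOL-Analysis.Cartesian_Space"
begin

text \<open>
  \<open>I(C)\<close> is spanned by the differences of monomials of equal weight, so a standard basis of it can be
  read off from a rewriting system on monomials.  Orient each \<open>f\<^sub>i\<close>, together with
  \<open>f\<^sub>6 = x\<^sub>2\<^bsup>a\<^sub>2 + a\<^sub>1\<^sub>2\<^esup> - x\<^sub>1\<^bsup>a\<^sub>1\<^esup> x\<^sub>3\<^bsup>a\<^sub>2\<^sub>3\<^esup> x\<^sub>4\<^bsup>a\<^sub>2\<^sub>4 - a\<^sub>1\<^sub>4\<^esup>\<close>, so that the degree does not drop and ties raise the exponent
  of \<open>x\<^sub>1\<close>.  All critical pairs close, hence every weight has exactly one normal form, and this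
  normal form has the largest degree among the monomials of that weight.  A coefficient comparison
  weight by weight then puts every initial form into the ideal of the initial forms of
  \<open>f\<^sub>1, \<dots>, f\<^sub>6\<close>.  Modulo \<open>x\<^sub>1\<close> the six initial forms are, up to sign, monomials none of which divides another,
  so they generate minimally.
\<close>

section \<open>Ideals of the polynomial ring\<close>

text \<open>Negation is multiplication by -1 and the ring is commutative, so closure under addition
  and one-sided absorption suffice.\<close>

lemma ideal_mpoly4_iff:
  "ideal J (mpoly4_ring :: 'k::field mpoly4 ring) \<longleftrightarrow>
     0 \<in> J \<and> (\<forall>f\<in>J. \<forall>g\<in>J. f + g \<in> J) \<and> (\<forall>f\<in>J. \<forall>g. g * f \<in> J)"
    (is "?L \<longleftrightarrow> ?R")
proof
  let ?P = "mpoly4_ring :: 'k mpoly4 ring"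
  have ring: "ring ?P"
    by (rule cring.axioms(1)[OF cring_mpoly4_ring])
  show ?R if ?L
  proof -
    interpret ideal J ?P by (rule that)
    show ?thesis
      using additive_subgroup.zero_closed[OF is_additive_subgroup]
        additive_subgroup.a_closed[OF is_additive_subgroup] I_l_closed
      by (simp add: mpoly4_ring_def)
  qed
  show ?L if R: ?R
  proof (rule idealI[OF ring])
    have neg: "- f \<in> J" if "f \<in> J" for f
      using R that by (metis mult_minus1)
    have "inv\<^bsub>add_monoid ?P\<^esub> f = - f" for f
    proof -
      interpret ring ?P by (rule ring)
      show ?thesis
        using add.inv_equality[of "- f" f] by (simp add: mpoly4_ring_def a_inv_def)
    qed
    then show "subgroup J (add_monoid ?P)"
      using R neg by (intro subgroup.intro) (auto simp: mpoly4_ring_def)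
  qed (use R in \<open>auto simp: mpoly4_ring_def mult.commute\<close>)
qed

lemma ideal_Idl_mpoly4: "ideal (Idl\<^bsub>mpoly4_ring\<^esub> A) (mpoly4_ring :: 'k::field mpoly4 ring)"
  by (rule ring.genideal_ideal[OF cring.axioms(1)[OF cring_mpoly4_ring]])
    (simp add: mpoly4_ring_def)

lemma Idl_mpoly4_least:
  assumes "ideal J (mpoly4_ring :: 'k::field mpoly4 ring)" "A \<subseteq> J"
  shows "Idl\<^bsub>mpoly4_ring\<^esub> A \<subseteq> J"
  by (rule ring.genideal_minimal[OF cring.axioms(1)[OF cring_mpoly4_ring] assms])

lemma Idl_mpoly4_superset: "A \<subseteq> Idl\<^bsub>mpoly4_ring :: 'k::field mpoly4 ring\<^esub> A"
  by (rule ring.genideal_self[OF cring.axioms(1)[OF cring_mpoly4_ring]])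
    (simp add: mpoly4_ring_def)

context
  fixes J :: "'k::field mpoly4 set"
  assumes J: "ideal J mpoly4_ring"
begin

lemma ideal_zero: "0 \<in> J"
  and ideal_add: "f \<in> J \<Longrightarrow> g \<in> J \<Longrightarrow> f + g \<in> J"
  and ideal_mult: "f \<in> J \<Longrightarrow> h * f \<in> J"
  using J by (simp_all add: ideal_mpoly4_iff)

lemma ideal_uminus: "f \<in> J \<Longrightarrow> - f \<in> J"
  using ideal_mult[of f "- 1"] by simp

lemma ideal_uminus_iff: "- f \<in> J \<longleftrightarrow> f \<in> J"
  using ideal_uminus[of f] ideal_uminus[of "- f"] by auto

end

text \<open>An ideal containing all generators but the \<open>i\<close>-th shows that the
  \<open>i\<close>-th cannot be dropped. Such ideals also force distinctness, since a repeated entry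
  would lie both inside and outside of one of them.\<close>

lemma minimally_generates_mpoly4I:
  fixes gs :: "'k::field mpoly4 list"
  assumes "Idl\<^bsub>mpoly4_ring\<^esub> (set gs) = I"
    and sep: "\<And>i. i < length gs \<Longrightarrow>
      \<exists>T. ideal T mpoly4_ring \<and> gs ! i \<notin> T \<and> (\<forall>j < length gs. j \<noteq> i \<longrightarrow> gs ! j \<in> T)"
  shows "minimally_generates mpoly4_ring gs I"
  unfolding minimally_generates_def
proof (intro conjI allI impI)
  show "distinct gs"
    unfolding distinct_conv_nth using sep by metis
  show "set gs \<subseteq> carrier mpoly4_ring"
    by (simp add: mpoly4_ring_def)
  show "Idl\<^bsub>mpoly4_ring\<^esub> (set gs) = I" by fact
next
  fix S assume S: "S \<subset> set gs"
  then obtain i where i: "i < length gs" "gs ! i \<notin> S"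
    by (metis in_set_conv_nth psubset_imp_ex_mem Diff_iff)
  from sep[OF i(1)] obtain T where T: "ideal T mpoly4_ring" "gs ! i \<notin> T"
    "\<forall>j < length gs. j \<noteq> i \<longrightarrow> gs ! j \<in> T" by blast
  have "S \<subseteq> T"
  proof
    fix g assume "g \<in> S"
    then obtain j where "j < length gs" "gs ! j = g"
      using S by (metis in_set_conv_nth psubsetD)
    then show "g \<in> T"
      using T(3) i(2) \<open>g \<in> S\<close> by auto
  qed
  then have "gs ! i \<notin> Idl\<^bsub>mpoly4_ring\<^esub> S"
    using Idl_mpoly4_least[OF T(1)] T(2) by blast
  moreover have "gs ! i \<in> Idl\<^bsub>mpoly4_ring\<^esub> (set gs)"
    using Idl_mpoly4_superset i(1) by (meson nth_mem subsetD)
  ultimately show "Idl\<^bsub>mpoly4_ring\<^esub> S \<noteq> I"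
    using assms(1) by blast
qed

text \<open>\<open>U\<close> is the exponent set of a monomial ideal. These ideals serve as
  separating ideals and as bounds on the pure powers occurring in \<open>I(C)\<close>.\<close>

lemma ideal_keys_subset:
  fixes U :: "(4 \<Rightarrow>\<^sub>0 nat) set"
  assumes up: "\<And>m c. m \<in> U \<Longrightarrow> c + m \<in> U"
  shows "ideal {f :: 'k::field mpoly4. Poly_Mapping.keys f \<subseteq> U} mpoly4_ring"
  unfolding ideal_mpoly4_iff
proof (intro conjI ballI allI)
  fix f g :: "'k mpoly4"
  assume f: "f \<in> {f. Poly_Mapping.keys f \<subseteq> U}"
  show "g * f \<in> {f. Poly_Mapping.keys f \<subseteq> U}"
    using keys_mult[of g f] up f by fast
  assume "g \<in> {f. Poly_Mapping.keys f \<subseteq> U}"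
  then show "f + g \<in> {f. Poly_Mapping.keys f \<subseteq> U}"
    using keys_add[of f g] f by fast
qed simp

section \<open>Linear extension from monomials\<close>

text \<open>The linear map with prescribed values on monomials; scalars act as constant polynomials
  \<open>Poly_Mapping.single 0 c\<close>.\<close>

definition linear_extension :: "('m \<Rightarrow> 'm \<Rightarrow>\<^sub>0 'k) \<Rightarrow> ('m \<Rightarrow>\<^sub>0 'k) \<Rightarrow> ('m::monoid_add \<Rightarrow>\<^sub>0 'k::comm_ring_1)" where
  "linear_extension \<phi> f =
     (\<Sum>m\<in>Poly_Mapping.keys f. Poly_Mapping.single 0 (Poly_Mapping.lookup f m) * \<phi> m)"

lemma linear_extension_single:
  "linear_extension \<phi> (Poly_Mapping.single m c) = Poly_Mapping.single 0 c * \<phi> m"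
  by (cases "c = 0") (simp_all add: linear_extension_def)

lemma linear_extension_add:
  "linear_extension \<phi> (f + g) = linear_extension \<phi> f + linear_extension \<phi> g"
  unfolding linear_extension_def
  by (rule setsum_keys_plus_distrib) (simp_all add: single_add distrib_right)

lemma linear_extension_diff:
  "linear_extension \<phi> (f - g) = linear_extension \<phi> f - linear_extension \<phi> g"
  using linear_extension_add[of \<phi> "f - g" g] by (simp add: algebra_simps)

lemma lookup_linear_extension:
  fixes f :: "'m::monoid_add \<Rightarrow>\<^sub>0 'k::comm_ring_1"
  shows "Poly_Mapping.lookup (linear_extension \<phi> f) k =
     (\<Sum>m\<in>Poly_Mapping.keys f. Poly_Mapping.lookup f m * Poly_Mapping.lookup (\<phi> m) k)"
proof -
  have "Poly_Mapping.lookup (Poly_Mapping.single 0 c * g) k = c * Poly_Mapping.lookup g k"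
    for c and g :: "'m \<Rightarrow>\<^sub>0 'k"
    by (auto simp: mult_map_scale_conv_mult[symmetric] Poly_Mapping.map.rep_eq when_def)
  then show ?thesis
    by (simp add: linear_extension_def lookup_sum)
qed

lemma poly_mapping_additive_induct [case_names single add]:
  fixes f :: "'a \<Rightarrow>\<^sub>0 'b::comm_monoid_add"
  assumes "\<And>m c. P (Poly_Mapping.single m c)" "\<And>f g. P f \<Longrightarrow> P g \<Longrightarrow> P (f + g)"
  shows "P f"
proof (induction f rule: update_induct)
  case const
  then show ?case using assms(1)[of undefined 0] by simp
next
  case (update f a b)
  \<comment> \<open>The key \<open>a\<close> is new to \<open>f\<close>, so updating there amounts
    to adding a single term.\<close>
  then have "Poly_Mapping.update a b f = Poly_Mapping.single a b + f"
    by (intro poly_mapping_eqI)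
      (auto simp: lookup_update lookup_add lookup_single in_keys_iff when_def)
  then show ?case using assms update.IH by metis
qed

section \<open>Confluent rewriting of monomials\<close>

text \<open>Exponent vectors are added where monomials are multiplied: a step replaces a divisor
  \<open>l\<close> of a monomial by \<open>r\<close> and keeps the cofactor
  \<open>c\<close>.\<close>

definition rewriting :: "('m::monoid_add \<times> 'm) set \<Rightarrow> 'm rel" where
  "rewriting R = {(c + l, c + r) | c l r. (l, r) \<in> R}"

definition joinable :: "'a rel \<Rightarrow> 'a \<Rightarrow> 'a \<Rightarrow> bool" where
  "joinable S a b \<longleftrightarrow> (\<exists>d. (a, d) \<in> S\<^sup>* \<and> (b, d) \<in> S\<^sup>*)"

lemma joinable_sym: "joinable S a b \<Longrightarrow> joinable S b a"
  unfolding joinable_def by blast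

text \<open>Newman's lemma: termination turns local confluence into confluence, by well-founded
  induction on the common source.\<close>

lemma newman:
  assumes "wf (S\<inverse>)"
    and local: "\<And>a b c. (a, b) \<in> S \<Longrightarrow> (a, c) \<in> S \<Longrightarrow> joinable S b c"
    and "(a, b) \<in> S\<^sup>*" "(a, c) \<in> S\<^sup>*"
  shows "joinable S b c"
  using assms(1,3,4)
proof (induction a arbitrary: b c rule: wf_induct_rule)
  case (less a)
  show ?case
  proof (cases "a = b \<or> a = c")
    case True
    then show ?thesis using less.prems unfolding joinable_def by blast
  next
    case False
    obtain b' where b': "(a, b') \<in> S" "(b', b) \<in> S\<^sup>*"
      using less.prems(1) False by (meson converse_rtranclE)
    obtain c' where c': "(a, c') \<in> S" "(c', c) \<in> S\<^sup>*"
      using less.prems(2) False by (meson converse_rtranclE)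
    obtain d where d: "(b', d) \<in> S\<^sup>*" "(c', d) \<in> S\<^sup>*"
      using local[OF b'(1) c'(1)] unfolding joinable_def by blast
    \<comment> \<open>The induction hypothesis is used at \<open>b'\<close> to merge
      \<open>b\<close> with \<open>d\<close>, then at \<open>c'\<close> to merge \<open>c\<close>
      with the resulting \<open>e\<close>.\<close>
    obtain e where e: "(b, e) \<in> S\<^sup>*" "(d, e) \<in> S\<^sup>*"
      using less.IH[of b' b d] b' d unfolding joinable_def by blast
    then have "(c', e) \<in> S\<^sup>*" using d by auto
    then obtain g where "(c, g) \<in> S\<^sup>*" "(e, g) \<in> S\<^sup>*"
      using less.IH[of c' c e] c' unfolding joinable_def by blast
    then show ?thesis using e unfolding joinable_def by (meson rtrancl_trans)
  qed
qed

section \<open>Compatibility of rewriting with multiplication by monomials\<close>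

lemma rewriting_add:
  fixes c :: "'m::monoid_add"
  assumes "(a, b) \<in> rewriting R"
  shows "(c + a, c + b) \<in> rewriting R"
proof -
  from assms obtain d l r where "a = d + l" "b = d + r" "(l, r) \<in> R"
    unfolding rewriting_def by blast
  then show ?thesis
    unfolding rewriting_def by (auto simp: add.assoc[symmetric])
qed

lemma rewriting_rtrancl_add:
  fixes c :: "'m::monoid_add"
  assumes "(a, b) \<in> (rewriting R)\<^sup>*"
  shows "(c + a, c + b) \<in> (rewriting R)\<^sup>*"
  using assms by induction (auto intro: rewriting_add rtrancl_into_rtrancl)

lemma joinable_rewriting_add:
  fixes c :: "'m::monoid_add"
  shows "joinable (rewriting R) a b \<Longrightarrow> joinable (rewriting R) (c + a) (c + b)"
  unfolding joinable_def using rewriting_rtrancl_add by blast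

definition locally_confluent :: "('m::monoid_add \<times> 'm) set \<Rightarrow> bool" where
  "locally_confluent R \<longleftrightarrow>
     (\<forall>a b c. (a, b) \<in> rewriting R \<longrightarrow> (a, c) \<in> rewriting R \<longrightarrow> joinable (rewriting R) b c)"

locale convergent_rewriting =
  fixes R :: "('m::comm_monoid_add \<times> 'm) set"
  assumes wf_rewriting: "wf ((rewriting R)\<inverse>)"
    and locally_confluent: "locally_confluent R"
begin

text \<open>Any irreducible reduct may be chosen: termination provides one, and confluence makes it
  unique.\<close>

definition normal_form :: "'m \<Rightarrow> 'm" where
  "normal_form a = (SOME b. (a, b) \<in> (rewriting R)\<^sup>* \<and> b \<notin> Domain (rewriting R))"

lemma normal_form: "(a, normal_form a) \<in> (rewriting R)\<^sup>*" "normal_form a \<notin> Domain (rewriting R)"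
proof -
  have "\<exists>b. (a, b) \<in> (rewriting R)\<^sup>* \<and> b \<notin> Domain (rewriting R)"
    using wf_rewriting
  proof (induction a rule: wf_induct_rule)
    case (less a)
    show ?case
    proof (cases "a \<in> Domain (rewriting R)")
      case True
      then obtain a' where "(a, a') \<in> rewriting R" by blast
      then show ?thesis using less[of a'] by (meson converse_rtrancl_into_rtrancl converse_iff)
    qed blast
  qed
  then have "(a, normal_form a) \<in> (rewriting R)\<^sup>* \<and> normal_form a \<notin> Domain (rewriting R)"
    unfolding normal_form_def by (rule someI_ex)
  then show "(a, normal_form a) \<in> (rewriting R)\<^sup>*" "normal_form a \<notin> Domain (rewriting R)"
    by auto
qed

text \<open>Both normal forms are reducts of \<open>a\<close>, so they have a common reduct; being
  irreducible, each reaches only itself.\<close>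

lemma normal_form_eq:
  assumes "(a, b) \<in> (rewriting R)\<^sup>*"
  shows "normal_form a = normal_form b"
proof -
  have "(a, normal_form b) \<in> (rewriting R)\<^sup>*"
    using assms normal_form(1) by (rule rtrancl_trans)
  moreover have local: "joinable (rewriting R) b c"
    if "(a, b) \<in> rewriting R" "(a, c) \<in> rewriting R" for a b c
    using locally_confluent that unfolding locally_confluent_def by blast
  ultimately have "joinable (rewriting R) (normal_form a) (normal_form b)"
    using newman[OF wf_rewriting local normal_form(1)] by simp
  then obtain d where "(normal_form a, d) \<in> (rewriting R)\<^sup>*" "(normal_form b, d) \<in> (rewriting R)\<^sup>*"
    unfolding joinable_def by blast
  moreover have "d = normal_form e" if "(normal_form e, d) \<in> (rewriting R)\<^sup>*" for e
    using that normal_form(2)[of e] by (cases rule: converse_rtranclE) auto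
  ultimately show ?thesis by metis
qed

lemma normal_form_add: "normal_form (c + normal_form a) = normal_form (c + a)"
  using normal_form_eq[OF rewriting_rtrancl_add[OF normal_form(1)]] by simp

lemma normal_form_rule:
  assumes "(l, r) \<in> R"
  shows "normal_form l = normal_form r"
proof -
  have "(0 + l, 0 + r) \<in> rewriting R"
    unfolding rewriting_def using assms by blast
  then show ?thesis by (intro normal_form_eq) auto
qed

end

section \<open>Weights and initial forms\<close>

text \<open>The exponent of \<open>t\<close> in the image of the monomial under
  \<open>x_i \<mapsto> t ^ n_i\<close>.\<close>

definition weight :: "(4 \<Rightarrow> nat) \<Rightarrow> (4 \<Rightarrow>\<^sub>0 nat) \<Rightarrow> nat" where
  "weight n m = (\<Sum>i\<in>UNIV. Poly_Mapping.lookup m i * n i)"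

lemma weight_add: "weight n (l + m) = weight n l + weight n m"
  by (simp add: weight_def lookup_add sum.distrib distrib_right)

lemma total_degree_add: "total_degree (l + m) = total_degree l + total_degree m"
  by (simp add: total_degree_def lookup_add sum.distrib)

lemma total_degree_le_weight:
  assumes "\<And>i. 0 < n i"
  shows "total_degree m \<le> weight n m"
  unfolding total_degree_def weight_def using assms
  by (intro sum_mono) (simp add: Suc_le_eq)

lemma lookup_le_total_degree: "Poly_Mapping.lookup m i \<le> total_degree m"
  unfolding total_degree_def by (rule member_le_sum) auto

lemma prod_monom_1: "(\<Prod>i\<in>A. Polynomial.monom (1 :: 'k::comm_semiring_1) (g i)) = Polynomial.monom 1 (\<Sum>i\<in>A. g i)"
  by (induction A rule: infinite_finite_induct) (auto simp: mult_monom)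

text \<open>A monomial of weight \<open>s\<close> maps to \<open>t ^ s\<close>. Membership in
  \<open>I(C)\<close> therefore means that the coefficients sum to zero within each weight.\<close>

lemma coeff_curve_hom:
  "Polynomial.coeff (curve_hom n f) s =
     (\<Sum>m\<in>Poly_Mapping.keys f. if weight n m = s then Poly_Mapping.lookup f m else 0)"
  by (simp add: curve_hom_def monom_power prod_monom_1 coeff_sum weight_def mult.commute if_distrib
      cong: if_cong)

lemma curve_hom_monomial: "curve_hom n (Poly_Mapping.single m c) = Polynomial.monom c (weight n m)"
  by (cases "c = 0") (auto simp: poly_eq_iff coeff_curve_hom)

lemma curve_hom_diff: "curve_hom n (f - g) = curve_hom n f - curve_hom n g"
  using curve_hom_add[of n "f - g" g] by (simp add: algebra_simps)

lemma monomial_diff_in_curve_ideal_iff: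
  "(Poly_Mapping.single l 1 - Poly_Mapping.single r 1 :: 'k::field mpoly4) \<in> curve_ideal n \<longleftrightarrow>
     weight n l = weight n r"
  by (simp add: curve_ideal_def curve_hom_diff curve_hom_monomial monom_eq_iff')

section \<open>Initial forms of polynomials and of rules\<close>

lemma lookup_homogeneous_summand:
  "Poly_Mapping.lookup (homogeneous_summand d f) m =
     (if total_degree m = d then Poly_Mapping.lookup f m else 0)"
  by (auto simp: homogeneous_summand_def lookup_sum lookup_single when_def in_keys_iff)

lemma initial_form_eqI:
  assumes "homogeneous_summand d f \<noteq> 0" "\<And>m. total_degree m < d \<Longrightarrow> Poly_Mapping.lookup f m = 0"
  shows "initial_form f = homogeneous_summand d f"
proof -
  have "(LEAST e. homogeneous_summand e f \<noteq> 0) = d"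
  proof (rule Least_equality)
    show "d \<le> e" if "homogeneous_summand e f \<noteq> 0" for e
    proof (rule ccontr)
      assume "\<not> d \<le> e"
      then have "homogeneous_summand e f = 0"
        using assms(2) by (intro poly_mapping_eqI) (auto simp: lookup_homogeneous_summand)
      with that show False by simp
    qed
  qed (rule assms(1))
  then show ?thesis by (simp add: initial_form_def)
qed

lemma initial_form_cases:
  assumes "f \<noteq> 0"
  obtains d where "initial_form f = homogeneous_summand d f"
    "\<And>m. total_degree m < d \<Longrightarrow> Poly_Mapping.lookup f m = 0"
proof -
  define d where "d = (LEAST d. homogeneous_summand d f \<noteq> 0)"
  have "Poly_Mapping.lookup f m = 0" if "total_degree m < d" for m
  proof -
    have "homogeneous_summand (total_degree m) f = 0"
      using not_less_Least that unfolding d_def by blast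
    then show ?thesis
      using lookup_homogeneous_summand[of "total_degree m" f m] by simp
  qed
  then show ?thesis
    using that[of d] by (simp add: initial_form_def d_def)
qed

text \<open>The initial form of the binomial of a rule whose degree does not drop; a tie in degree
  keeps both terms.\<close>

definition rule_initial_form :: "(4 \<Rightarrow>\<^sub>0 nat) \<times> (4 \<Rightarrow>\<^sub>0 nat) \<Rightarrow> 'k::field mpoly4" where
  "rule_initial_form = (\<lambda>(l, r).
     if total_degree l < total_degree r then Poly_Mapping.single l 1
     else Poly_Mapping.single l 1 - Poly_Mapping.single r 1)"

lemma rule_initial_form:
  assumes "l \<noteq> r" "total_degree l \<le> total_degree r"
  shows "initial_form (Poly_Mapping.single l 1 - Poly_Mapping.single r 1) =
    (rule_initial_form (l, r) :: 'k::field mpoly4)" (is "initial_form ?f = _")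
proof -
  have "homogeneous_summand (total_degree l) ?f = rule_initial_form (l, r)"
    using assms(2)
    by (intro poly_mapping_eqI)
      (auto simp: rule_initial_form_def lookup_homogeneous_summand lookup_minus lookup_single when_def)
  moreover have "Poly_Mapping.lookup (rule_initial_form (l, r) :: 'k mpoly4) l = 1"
    using assms(1) by (simp add: rule_initial_form_def lookup_minus lookup_single when_def)
  ultimately show ?thesis
    using assms(2)
    by (subst initial_form_eqI[of "total_degree l"])
      (auto simp: lookup_minus lookup_single when_def)
qed

text \<open>
  The left-hand sides are the leading monomials for the local degree reverse lexicographic order in
  which \<open>x\<^sub>1\<close> is the smallest variable.  Rewriting terminates because it preserves the weight, which
  bounds both the degree and the exponent of \<open>x\<^sub>1\<close>.
\<close>

locale curve_rewriting =
  fixes n :: "4 \<Rightarrow> nat" and R :: "((4 \<Rightarrow>\<^sub>0 nat) \<times> (4 \<Rightarrow>\<^sub>0 nat)) set"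
  assumes pos: "\<And>i. 0 < n i"
    and weight_rule: "\<And>l r. (l, r) \<in> R \<Longrightarrow> weight n l = weight n r"
    and degree_rule: "\<And>l r. (l, r) \<in> R \<Longrightarrow> total_degree l < total_degree r \<or>
      total_degree l = total_degree r \<and> Poly_Mapping.lookup l 1 < Poly_Mapping.lookup r 1"
    and confluent: "locally_confluent R"
begin

section \<open>Weight and degree along rewriting, and termination\<close>

lemma weight_rewriting: "(a, b) \<in> rewriting R \<Longrightarrow> weight n a = weight n b"
  unfolding rewriting_def using weight_rule by (auto simp: weight_add)

lemma degree_rewriting: "(a, b) \<in> rewriting R \<Longrightarrow> total_degree a < total_degree b \<or>
      total_degree a = total_degree b \<and> Poly_Mapping.lookup a 1 < Poly_Mapping.lookup b 1"
  unfolding rewriting_def using degree_rule by (fastforce simp: total_degree_add lookup_add)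

sublocale convergent_rewriting R
proof
  show "locally_confluent R" by (rule confluent)
  have "(rewriting R)\<inverse> \<subseteq>
    measures [\<lambda>m. weight n m - total_degree m, \<lambda>m. weight n m - Poly_Mapping.lookup m 1]"
  proof
    fix p assume "p \<in> (rewriting R)\<inverse>"
    then obtain a b where p: "p = (b, a)" "(a, b) \<in> rewriting R" by auto
    \<comment> \<open>The measures use truncated subtraction; this bound keeps the differences
      genuine, so a gain in degree or in the exponent of \<open>x_1\<close> strictly decreases
      them.\<close>
    have "total_degree b \<le> weight n b"
      by (rule total_degree_le_weight) (rule pos)
    then show "p \<in> measures [\<lambda>m. weight n m - total_degree m, \<lambda>m. weight n m - Poly_Mapping.lookup m 1]"
      using degree_rewriting[OF p(2)] weight_rewriting[OF p(2)]
        lookup_le_total_degree[of b 1]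
      by (auto simp: p(1))
  qed
  then show "wf ((rewriting R)\<inverse>)"
    by (rule wf_subset[OF wf_measures])
qed

lemma weight_rewriting_rtrancl: "(a, b) \<in> (rewriting R)\<^sup>* \<Longrightarrow> weight n a = weight n b"
  by (induction rule: rtrancl_induct) (auto dest: weight_rewriting)

lemma degree_rewriting_rtrancl: "(a, b) \<in> (rewriting R)\<^sup>* \<Longrightarrow> total_degree a \<le> total_degree b"
  by (induction rule: rtrancl_induct) (auto dest: degree_rewriting)

text \<open>By bilinearity it is enough to treat monomials, where it is
  \<open>normal_form_add\<close>. It makes the kernel of \<open>\<Psi>\<close> an ideal.\<close>

lemma linear_extension_normal_form_mult:
  fixes f g :: "'k::field mpoly4"
  defines "\<Psi> \<equiv> linear_extension (\<lambda>m. Poly_Mapping.single (normal_form m) 1)"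
  shows "\<Psi> (g * f) = \<Psi> (g * \<Psi> f)"
proof (induction g rule: poly_mapping_additive_induct)
  case (single k c)
  show ?case
  proof (induction f rule: poly_mapping_additive_induct)
    case (single m d)
    show ?case
      by (simp add: \<Psi>_def mult_single linear_extension_single normal_form_add)
  next
    case (add f g)
    then show ?case by (simp add: \<Psi>_def linear_extension_add distrib_left)
  qed
next
  case (add g h)
  then show ?case by (simp add: \<Psi>_def linear_extension_add distrib_right)
qed

text \<open>The kernel of \<open>\<Psi>\<close> is an ideal containing the binomials of all rules,
  hence all of \<open>I(C)\<close>. It thus contains the difference of two monomials of equal
  weight, whose normal forms must then agree.\<close>

lemma normal_form_unique:
  assumes gen: "(curve_ideal n :: 'k::field mpoly4 set) \<subseteq>
      Idl\<^bsub>mpoly4_ring\<^esub> ((\<lambda>(l, r). Poly_Mapping.single l 1 - Poly_Mapping.single r 1) ` R)"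
    and "weight n a = weight n b"
  shows "normal_form a = normal_form b"
proof -
  define \<Psi> :: "'k mpoly4 \<Rightarrow> 'k mpoly4"
    where "\<Psi> = linear_extension (\<lambda>m. Poly_Mapping.single (normal_form m) 1)"
  let ?T = "{f. \<Psi> f = 0}"
  have "\<Psi> (g * f) = 0" if "\<Psi> f = 0" for f g
    using linear_extension_normal_form_mult[of g f] that
    by (simp add: \<Psi>_def) (simp add: linear_extension_def)
  then have "ideal ?T mpoly4_ring"
    unfolding ideal_mpoly4_iff
    by (auto simp: \<Psi>_def linear_extension_add) (simp add: linear_extension_def)
  moreover have "(\<lambda>(l, r). Poly_Mapping.single l 1 - Poly_Mapping.single r 1) ` R \<subseteq> ?T"
    by (auto simp: \<Psi>_def linear_extension_diff linear_extension_single dest: normal_form_rule)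
  ultimately have "curve_ideal n \<subseteq> ?T"
    using gen Idl_mpoly4_least by blast
  moreover have "(Poly_Mapping.single a 1 - Poly_Mapping.single b 1) \<in> (curve_ideal n :: 'k mpoly4 set)"
    using assms(2) by (simp add: monomial_diff_in_curve_ideal_iff)
  ultimately have "\<Psi> (Poly_Mapping.single a 1 - Poly_Mapping.single b 1) = 0"
    by blast
  then have "Poly_Mapping.single (normal_form a) (1 :: 'k) = Poly_Mapping.single (normal_form b) 1"
    by (simp add: \<Psi>_def linear_extension_diff linear_extension_single)
  then show ?thesis
    by (metis lookup_single_eq lookup_single_not_eq zero_neq_one)
qed

text \<open>A step that raises the degree starts at a multiple of a monomial initial form, which is
  zero modulo \<open>J\<close>; a step that keeps the degree exchanges monomials congruent modulo
  \<open>J\<close>. Degrees never drop, so equal degrees at both ends mean that no step raised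
  them.\<close>

lemma rewriting_modulo_initial_forms:
  fixes J :: "'k::field mpoly4 set"
  defines "J \<equiv> Idl\<^bsub>mpoly4_ring\<^esub> (rule_initial_form ` R)"
  assumes "(a, b) \<in> (rewriting R)\<^sup>*"
  shows "Poly_Mapping.single a 1 -
    (if total_degree a = total_degree b then Poly_Mapping.single b 1 else 0) \<in> J"
  using assms(2)
proof (induction rule: converse_rtrancl_induct)
  have J: "ideal J mpoly4_ring"
    unfolding J_def by (rule ideal_Idl_mpoly4)
  case base
  show ?case using ideal_zero[OF J] by simp
next
  have J: "ideal J mpoly4_ring"
    unfolding J_def by (rule ideal_Idl_mpoly4)
  case (step a a')
  from step(1) obtain c l r where lr: "a = c + l" "a' = c + r" "(l, r) \<in> R"
    unfolding rewriting_def by blast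
  have "(rule_initial_form (l, r) :: 'k mpoly4) \<in> J"
    unfolding J_def using Idl_mpoly4_superset lr(3) by blast
  then have rule: "Poly_Mapping.single c 1 * (rule_initial_form (l, r) :: 'k mpoly4) \<in> J"
    by (rule ideal_mult[OF J])
  have mono: "total_degree a' \<le> total_degree b"
    using step(2) by (rule degree_rewriting_rtrancl)
  show ?case
  proof (cases "total_degree a < total_degree a'")
    case True
    then have "Poly_Mapping.single a 1 \<in> J"
      using rule by (simp add: rule_initial_form_def lr total_degree_add mult_single)
    then show ?thesis using True mono by simp
  next
    case False
    then have eq: "total_degree a = total_degree a'"
      using degree_rewriting[OF step(1)] by auto
    then have "Poly_Mapping.single a 1 - Poly_Mapping.single a' 1 \<in> J"
      using rule by (simp add: rule_initial_form_def lr total_degree_add mult_single right_diff_distrib)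
    from ideal_add[OF J this step(3)] show ?thesis
      using eq by (simp add: algebra_simps)
  qed
qed

text \<open>Each rule contributes the initial form of an element of \<open>I(C)\<close>. Conversely,
  the lowest summand of \<open>f\<close> is reduced modulo the rule initial forms to a combination
  of normal forms, whose coefficients are those of \<open>curve_hom n f\<close> and hence
  vanish.\<close>

theorem initial_ideal_eq:
  assumes gen: "(curve_ideal n :: 'k::field mpoly4 set) \<subseteq>
      Idl\<^bsub>mpoly4_ring\<^esub> ((\<lambda>(l, r). Poly_Mapping.single l 1 - Poly_Mapping.single r 1) ` R)"
  shows "initial_ideal (curve_ideal n :: 'k mpoly4 set) =
    Idl\<^bsub>mpoly4_ring\<^esub> (rule_initial_form ` R)"
proof
  let ?J = "Idl\<^bsub>mpoly4_ring\<^esub> (rule_initial_form ` R) :: 'k mpoly4 set"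
  have J: "ideal ?J mpoly4_ring" by (rule ideal_Idl_mpoly4)
  have "rule_initial_form (l, r) \<in> {initial_form f | f. f \<in> (curve_ideal n :: 'k mpoly4 set) \<and> f \<noteq> 0}"
    if lr: "(l, r) \<in> R" for l r
  proof -
    let ?f = "Poly_Mapping.single l 1 - Poly_Mapping.single r 1 :: 'k mpoly4"
    have ne: "l \<noteq> r" and le: "total_degree l \<le> total_degree r"
      using degree_rule[OF lr] by auto
    have "Poly_Mapping.lookup ?f l \<noteq> 0"
      using ne by (simp add: lookup_minus lookup_single when_def)
    then have "?f \<noteq> 0" by auto
    moreover have "?f \<in> curve_ideal n"
      by (simp add: monomial_diff_in_curve_ideal_iff weight_rule[OF lr])
    ultimately show ?thesis
      using rule_initial_form[OF ne le, where 'k = 'k] by force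
  qed
  then have "rule_initial_form ` R \<subseteq> initial_ideal (curve_ideal n :: 'k mpoly4 set)"
    unfolding initial_ideal_def using Idl_mpoly4_superset by fastforce
  then show "?J \<subseteq> initial_ideal (curve_ideal n)"
    unfolding initial_ideal_def by (rule Idl_mpoly4_least[OF ideal_Idl_mpoly4])
  have "initial_form f \<in> ?J" if f: "f \<in> curve_ideal n" "f \<noteq> 0" for f :: "'k mpoly4"
  proof -
    obtain d where d: "initial_form f = homogeneous_summand d f"
      and low: "\<And>m. total_degree m < d \<Longrightarrow> Poly_Mapping.lookup f m = 0"
      using initial_form_cases[OF f(2)] by blast
    \<comment> \<open>\<open>\<theta>\<close> is reduction modulo \<open>?J\<close>: a monomial
      whose normal form has larger degree becomes 0, any other becomes its normal form.\<close>
    define \<theta> :: "(4 \<Rightarrow>\<^sub>0 nat) \<Rightarrow> 'k mpoly4" where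
      "\<theta> m = (if total_degree m = total_degree (normal_form m)
              then Poly_Mapping.single (normal_form m) 1 else 0)" for m
    have "g - linear_extension \<theta> g \<in> ?J" for g
    proof (induction g rule: poly_mapping_additive_induct)
      case (single m c)
      have "Poly_Mapping.single m 1 - \<theta> m \<in> ?J"
        unfolding \<theta>_def by (rule rewriting_modulo_initial_forms[OF normal_form(1)])
      from ideal_mult[OF J this, of "Poly_Mapping.single 0 c"] show ?case
        by (simp add: linear_extension_single right_diff_distrib mult_single)
    next
      case (add g h)
      from ideal_add[OF J add] show ?case
        by (simp add: linear_extension_add algebra_simps)
    qed
    moreover have "linear_extension \<theta> (homogeneous_summand d f) = 0"
    proof (rule poly_mapping_eqI)
      fix k
      let ?F = "homogeneous_summand d f"
      let ?A = "{m \<in> Poly_Mapping.keys ?F. total_degree m = total_degree (normal_form m) \<and> normal_form m = k}"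
      have sub: "Poly_Mapping.keys ?F \<subseteq> Poly_Mapping.keys f"
        by (auto simp: in_keys_iff lookup_homogeneous_summand split: if_splits)
      have "Poly_Mapping.lookup (linear_extension \<theta> ?F) k = (\<Sum>m\<in>?A. Poly_Mapping.lookup ?F m)"
        unfolding lookup_linear_extension
        by (rule sum.mono_neutral_cong_right) (auto simp: \<theta>_def lookup_single when_def split: if_splits)
      also have "\<dots> = 0"
      proof (cases "?A = {}")
        case False
        then obtain m0 where m0: "m0 \<in> Poly_Mapping.keys ?F"
          "total_degree m0 = total_degree (normal_form m0)" "normal_form m0 = k" by blast
        have d0: "total_degree m0 = d"
          using m0(1) by (auto simp: in_keys_iff lookup_homogeneous_summand split: if_splits)
        \<comment> \<open>The normal form \<open>k\<close> has the largest degree in its weight, and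
          that degree is \<open>d\<close> because of \<open>m0\<close>. As \<open>f\<close> has no
          terms below degree \<open>d\<close>, all its terms of this weight have degree exactly
          \<open>d\<close>, so the sum over \<open>?A\<close> is a full coefficient of
          \<open>curve_hom n f\<close>.\<close>
        have A: "?A = {m \<in> Poly_Mapping.keys f. weight n m = weight n m0}"
        proof (intro equalityI subsetI)
          fix m assume m: "m \<in> ?A"
          then have "weight n m = weight n k"
            using weight_rewriting_rtrancl[OF normal_form(1), of m] by auto
          also have "\<dots> = weight n m0"
            using weight_rewriting_rtrancl[OF normal_form(1), of m0] m0 by auto
          finally show "m \<in> {m \<in> Poly_Mapping.keys f. weight n m = weight n m0}"
            using m sub by blast
        next
          fix m assume m: "m \<in> {m \<in> Poly_Mapping.keys f. weight n m = weight n m0}"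
          then have nf: "normal_form m = k"
            using normal_form_unique[OF gen, of m m0] m0(3) by auto
          have "total_degree m \<le> d"
            using degree_rewriting_rtrancl[OF normal_form(1), of m] nf m0 d0 by simp
          moreover have "\<not> total_degree m < d"
            using low[of m] m by (auto simp: in_keys_iff)
          ultimately have "total_degree m = d" by simp
          then show "m \<in> ?A"
            using m nf m0 d0 by (auto simp: in_keys_iff lookup_homogeneous_summand)
        qed
        have "(\<Sum>m\<in>?A. Poly_Mapping.lookup ?F m) = (\<Sum>m\<in>?A. Poly_Mapping.lookup f m)"
          by (rule sum.cong)
            (auto simp: in_keys_iff lookup_homogeneous_summand split: if_splits)
        also have "\<dots> = Polynomial.coeff (curve_hom n f) (weight n m0)"
          unfolding A coeff_curve_hom by (simp add: sum.inter_filter)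
        also have "\<dots> = 0"
          using f(1) by (simp add: curve_ideal_def)
        finally show ?thesis .
      next
        case True
        then show ?thesis by (simp only: sum.empty)
      qed
      finally show "Poly_Mapping.lookup (linear_extension \<theta> ?F) k = Poly_Mapping.lookup 0 k"
        by simp
    qed
    ultimately show ?thesis
      unfolding d by (metis diff_zero)
  qed
  then show "initial_ideal (curve_ideal n :: 'k mpoly4 set) \<subseteq> ?J"
    unfolding initial_ideal_def by (intro Idl_mpoly4_least[OF J]) blast
qed

end

section \<open>Exponent vectors\<close>

definition expo :: "nat \<Rightarrow> nat \<Rightarrow> nat \<Rightarrow> nat \<Rightarrow> (4 \<Rightarrow>\<^sub>0 nat)" where
  "expo a b c d = Poly_Mapping.single 1 a + Poly_Mapping.single 2 b +
     Poly_Mapping.single 3 c + Poly_Mapping.single 4 d"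

lemma lookup_expo [simp]:
  "Poly_Mapping.lookup (expo a b c d) 1 = a"
  "Poly_Mapping.lookup (expo a b c d) 2 = b"
  "Poly_Mapping.lookup (expo a b c d) 3 = c"
  "Poly_Mapping.lookup (expo a b c d) 4 = d"
  by (simp_all add: expo_def lookup_add lookup_single when_def)

lemma expo_add [simp]: "expo a b c d + expo a' b' c' d' = expo (a + a') (b + b') (c + c') (d + d')"
  by (simp add: expo_def single_add ac_simps)

lemma expo_eq_iff [simp]: "expo a b c d = expo a' b' c' d' \<longleftrightarrow> a = a' \<and> b = b' \<and> c = c' \<and> d = d'"
  by (metis lookup_expo)

lemma expo_cases: obtains a b c d where "m = expo a b c d"
proof
  show "m = expo (Poly_Mapping.lookup m 1) (Poly_Mapping.lookup m 2)
    (Poly_Mapping.lookup m 3) (Poly_Mapping.lookup m 4)"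
  proof (rule poly_mapping_eqI)
    show "Poly_Mapping.lookup m k = Poly_Mapping.lookup (expo (Poly_Mapping.lookup m 1)
      (Poly_Mapping.lookup m 2) (Poly_Mapping.lookup m 3) (Poly_Mapping.lookup m 4)) k" for k
      using exhaust_4[of k] by (elim disjE) (simp_all only: lookup_expo)
  qed
qed

lemma weight_expo: "weight n (expo a b c d) = a * n 1 + b * n 2 + c * n 3 + d * n 4"
  by (simp only: weight_def sum_4 lookup_expo)

lemma total_degree_expo: "total_degree (expo a b c d) = a + b + c + d"
  by (simp only: total_degree_def sum_4 lookup_expo)

lemma X_power: "X i ^ k = Poly_Mapping.single (Poly_Mapping.single i k) 1"
  by (induction k) (simp_all add: X_def mult_single flip: single_add)

lemma ex_4: "(\<exists>i::4. P i) \<longleftrightarrow> P 1 \<or> P 2 \<or> P 3 \<or> P 4"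
  using forall_4[of "\<lambda>i. \<not> P i"] by auto

lemma expo_divides_iff:
  "(\<exists>m. expo a b c d = m + expo a' b' c' d') \<longleftrightarrow> a' \<le> a \<and> b' \<le> b \<and> c' \<le> c \<and> d' \<le> d"
proof
  assume "\<exists>m. expo a b c d = m + expo a' b' c' d'"
  then obtain m where m: "expo a b c d = m + expo a' b' c' d'" by blast
  then show "a' \<le> a \<and> b' \<le> b \<and> c' \<le> c \<and> d' \<le> d"
    by (cases m rule: expo_cases) auto
next
  assume "a' \<le> a \<and> b' \<le> b \<and> c' \<le> c \<and> d' \<le> d"
  then show "\<exists>m. expo a b c d = m + expo a' b' c' d'"
    by (intro exI[of _ "expo (a - a') (b - b') (c - c') (d - d')"]) simp
qed

lemma lookup_expo_eq_0_iff:
  "Poly_Mapping.lookup (expo a b c d) i = 0 \<longleftrightarrow>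
     (i = 1 \<longrightarrow> a = 0) \<and> (i = 2 \<longrightarrow> b = 0) \<and> (i = 3 \<longrightarrow> c = 0) \<and> (i = 4 \<longrightarrow> d = 0)"
  using exhaust_4[of i] by auto

section \<open>Critical pairs\<close>

lemma rewriting_rtranclI:
  assumes "(l, r) \<in> R" "a = c + l" "b = c + r"
  shows "(a, b) \<in> (rewriting R)\<^sup>*"
  unfolding rewriting_def using assms by blast

lemma joinableI: "(a, d) \<in> S\<^sup>* \<Longrightarrow> (b, d) \<in> S\<^sup>* \<Longrightarrow> joinable S a b"
  unfolding joinable_def by blast

text \<open>The common value \<open>c + l = c' + l'\<close> ranges over all common multiples of the
  two left-hand sides, not only the least one.\<close>

definition converging :: "('m::monoid_add \<times> 'm) set \<Rightarrow> 'm \<times> 'm \<Rightarrow> 'm \<times> 'm \<Rightarrow> bool" where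
  "converging R = (\<lambda>(l, r) (l', r').
     \<forall>c c'. c + l = c' + l' \<longrightarrow> joinable (rewriting R) (c + r) (c' + r'))"

lemma locally_confluentI:
  assumes "\<And>p q. p \<in> R \<Longrightarrow> q \<in> R \<Longrightarrow> converging R p q"
  shows "locally_confluent R"
  using assms unfolding locally_confluent_def converging_def rewriting_def by fast

lemma converging_sym: "converging R p q \<Longrightarrow> converging R q p"
  unfolding converging_def by (auto split: prod.splits) (metis joinable_sym)

text \<open>Cancelling \<open>l\<close> gives \<open>c = c'\<close>, so both results
  coincide.\<close>

lemma converging_refl:
  fixes R :: "('m::cancel_comm_monoid_add \<times> 'm) set"
  shows "converging R p p"
  unfolding converging_def joinable_def by auto

text \<open>Disjoint supports of \<open>u\<close> and \<open>u'\<close> make \<open>u + l\<close>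
  the least common multiple. Every other overlap is a monomial multiple of this one, and joinability
  survives multiplication.\<close>

lemma converging_overlap:
  fixes R :: "((4 \<Rightarrow>\<^sub>0 nat) \<times> (4 \<Rightarrow>\<^sub>0 nat)) set"
  assumes lcm: "u + l = u' + l'"
    and disjoint: "\<And>i. Poly_Mapping.lookup u i = 0 \<or> Poly_Mapping.lookup u' i = 0"
    and join: "joinable (rewriting R) (u + r) (u' + r')"
  shows "converging R (l, r) (l', r')"
  unfolding converging_def
proof (clarify)
  fix c c' assume eq: "c + l = c' + l'"
  \<comment> \<open>In each coordinate \<open>c - u\<close> and \<open>c' - u'\<close> agree as
    integers, and one of \<open>u\<close>, \<open>u'\<close> vanishes there, so the truncated
    difference is exact.\<close>
  have "c = (c - u) + u \<and> c' = (c - u) + u'"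
  proof -
    have "Poly_Mapping.lookup c i = (Poly_Mapping.lookup c i - Poly_Mapping.lookup u i) + Poly_Mapping.lookup u i \<and>
        Poly_Mapping.lookup c' i = (Poly_Mapping.lookup c i - Poly_Mapping.lookup u i) + Poly_Mapping.lookup u' i" for i
      using arg_cong[OF eq, of "\<lambda>m. Poly_Mapping.lookup m i"]
        arg_cong[OF lcm, of "\<lambda>m. Poly_Mapping.lookup m i"] disjoint[of i]
      by (auto simp: lookup_add)
    then show ?thesis
      by (simp add: poly_mapping_eq_iff fun_eq_iff lookup_add minus_poly_mapping.rep_eq)
  qed
  then show "joinable (rewriting R) (c + r) (c' + r')"
    using joinable_rewriting_add[OF join, of "c - u"] by (metis add.assoc)
qed

text \<open>Buchberger's product criterion: the left-hand sides do not interact, and both results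
  rewrite to \<open>r + r'\<close>.\<close>

lemma converging_coprime:
  fixes R :: "((4 \<Rightarrow>\<^sub>0 nat) \<times> (4 \<Rightarrow>\<^sub>0 nat)) set"
  assumes "(l, r) \<in> R" "(l', r') \<in> R"
    and "\<And>i. Poly_Mapping.lookup l i = 0 \<or> Poly_Mapping.lookup l' i = 0"
  shows "converging R (l, r) (l', r')"
proof (rule converging_overlap)
  show "l' + l = l + l'" by (rule add.commute)
  show "Poly_Mapping.lookup l' i = 0 \<or> Poly_Mapping.lookup l i = 0" for i
    using assms(3)[of i] by (rule disjE) simp_all
  have "(l' + r, r + r') \<in> (rewriting R)\<^sup>*" "(l + r', r + r') \<in> (rewriting R)\<^sup>*"
    using assms(1,2) by (auto intro: rewriting_rtranclI simp: add.commute)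
  then show "joinable (rewriting R) (l' + r) (l + r')"
    by (rule joinableI)
qed

text \<open>
  The first five rules are \<open>f\<^sub>1, \<dots>, f\<^sub>5\<close> with \<open>a\<^sub>1, \<dots>, a\<^sub>4\<close> eliminated by Bresinsky's relations; the
  sixth one is the critical pair of the first two.
\<close>

definition standard_rules ::
    "nat \<Rightarrow> nat \<Rightarrow> nat \<Rightarrow> nat \<Rightarrow> nat \<Rightarrow> nat \<Rightarrow> nat \<Rightarrow> nat \<Rightarrow> ((4 \<Rightarrow>\<^sub>0 nat) \<times> (4 \<Rightarrow>\<^sub>0 nat)) set" where
  "standard_rules a12 a14 a23 a24 a31 a32 a41 a43 =
    {(expo 0 a12 0 a14, expo (a31 + a41) 0 0 0),
     (expo 0 0 a23 a24, expo 0 (a12 + a32) 0 0),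
     (expo 0 0 (a23 + a43) 0, expo a31 a32 0 0),
     (expo 0 0 0 (a14 + a24), expo a41 0 a43 0),
     (expo 0 a12 a43 0, expo a31 0 0 a24),
     (expo 0 (a12 + a32 + a12) 0 0, expo (a31 + a41) 0 a23 (a24 - a14))}"

text \<open>Of the fifteen pairs of distinct rules six are coprime. In the other nine,
  \<open>u\<close> and \<open>u'\<close> are the cofactors of the least common multiple, and at most
  one step on each side joins the results.\<close>

lemma locally_confluent_standard_rules:
  assumes "a23 \<le> a43" "a14 \<le> a24"
  shows "locally_confluent (standard_rules a12 a14 a23 a24 a31 a32 a41 a43)"
proof -
  define R where "R = standard_rules a12 a14 a23 a24 a31 a32 a41 a43"
  define \<rho>1 where "\<rho>1 = (expo 0 a12 0 a14, expo (a31 + a41) 0 0 0)"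
  define \<rho>2 where "\<rho>2 = (expo 0 0 a23 a24, expo 0 (a12 + a32) 0 0)"
  define \<rho>3 where "\<rho>3 = (expo 0 0 (a23 + a43) 0, expo a31 a32 0 0)"
  define \<rho>4 where "\<rho>4 = (expo 0 0 0 (a14 + a24), expo a41 0 a43 0)"
  define \<rho>5 where "\<rho>5 = (expo 0 a12 a43 0, expo a31 0 0 a24)"
  define \<rho>6 where "\<rho>6 = (expo 0 (a12 + a32 + a12) 0 0, expo (a31 + a41) 0 a23 (a24 - a14))"
  note defs = \<rho>1_def \<rho>2_def \<rho>3_def \<rho>4_def \<rho>5_def \<rho>6_def
  have R: "R = {\<rho>1, \<rho>2, \<rho>3, \<rho>4, \<rho>5, \<rho>6}"
    unfolding R_def standard_rules_def defs ..
  have mem: "\<rho>1 \<in> R" "\<rho>2 \<in> R" "\<rho>3 \<in> R" "\<rho>4 \<in> R" "\<rho>5 \<in> R" "\<rho>6 \<in> R"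
    unfolding R by auto
  \<comment> \<open>\<open>steps(i)\<close> applies the \<open>i\<close>-th rule once; the cofactor
    \<open>c\<close> is the untouched part of the monomial.\<close>
  note steps = mem[unfolded defs, THEN rewriting_rtranclI]
  have c12: "converging R \<rho>1 \<rho>2"
    unfolding defs
    by (rule converging_overlap[where u = "expo 0 0 a23 (a24 - a14)" and u' = "expo 0 a12 0 0",
          OF _ _ joinableI[OF rtrancl_refl
            steps(6)[where c = "expo 0 0 0 0"]]])
      (use assms in \<open>simp_all add: lookup_expo_eq_0_iff\<close>)
  have c14: "converging R \<rho>1 \<rho>4"
    unfolding defs
    by (rule converging_overlap[where u = "expo 0 0 0 a24" and u' = "expo 0 a12 0 0",
          OF _ _ joinableI[OF rtrancl_refl
            steps(5)[where c = "expo a41 0 0 0"]]])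
      (use assms in \<open>simp_all add: lookup_expo_eq_0_iff\<close>)
  have c15: "converging R \<rho>1 \<rho>5"
    unfolding defs
    by (rule converging_overlap[where u = "expo 0 0 a43 0" and u' = "expo 0 0 0 a14",
          OF _ _ joinableI[OF rtrancl_refl
            steps(4)[where c = "expo a31 0 0 0"]]])
      (use assms in \<open>simp_all add: lookup_expo_eq_0_iff\<close>)
  have c16: "converging R \<rho>1 \<rho>6"
    unfolding defs
    by (rule converging_overlap[where u = "expo 0 (a12 + a32) 0 0" and u' = "expo 0 0 0 a14",
          OF _ _ joinableI[OF rtrancl_refl
            steps(2)[where c = "expo (a31 + a41) 0 0 0"]]])
      (use assms in \<open>simp_all add: lookup_expo_eq_0_iff\<close>)
  have c23: "converging R \<rho>2 \<rho>3"
    unfolding defs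
    by (rule converging_overlap[where u = "expo 0 0 a43 0" and u' = "expo 0 0 0 a24",
          OF _ _ joinableI[OF steps(5)[where c = "expo 0 a32 0 0"]
            rtrancl_refl]])
      (use assms in \<open>simp_all add: lookup_expo_eq_0_iff\<close>)
  have c24: "converging R \<rho>2 \<rho>4"
    unfolding defs
    by (rule converging_overlap[where u = "expo 0 0 0 a14" and u' = "expo 0 0 a23 0",
          OF _ _ joinableI[OF steps(1)[where c = "expo 0 a32 0 0"]
            steps(3)[where c = "expo a41 0 0 0"]]])
      (use assms in \<open>simp_all add: lookup_expo_eq_0_iff\<close>)
  \<comment> \<open>This overlap needs both inequalities: \<open>a23 \<le> a43\<close> determines
    the least common multiple, and \<open>a14 \<le> a24\<close> allows the steps to a common
    monomial.\<close>
  have c25: "converging R \<rho>2 \<rho>5"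
    unfolding defs
    by (rule converging_overlap[where u = "expo 0 a12 (a43 - a23) 0" and u' = "expo 0 0 0 a24",
          OF _ _ joinableI[OF steps(6)[where c = "expo 0 0 (a43 - a23) 0"]
            steps(4)[where c = "expo a31 0 0 (a24 - a14)"]]])
      (use assms in \<open>simp_all add: lookup_expo_eq_0_iff\<close>)
  have c35: "converging R \<rho>3 \<rho>5"
    unfolding defs
    by (rule converging_overlap[where u = "expo 0 a12 0 0" and u' = "expo 0 0 a23 0",
          OF _ _ joinableI[OF rtrancl_refl
            steps(2)[where c = "expo a31 0 0 0"]]])
      (use assms in \<open>simp_all add: lookup_expo_eq_0_iff\<close>)
  have c56: "converging R \<rho>5 \<rho>6"
    unfolding defs
    by (rule converging_overlap[where u = "expo 0 (a12 + a32) 0 0" and u' = "expo 0 0 a43 0",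
          OF _ _ joinableI[OF steps(1)[where c = "expo a31 a32 0 (a24 - a14)"]
            steps(3)[where c = "expo (a31 + a41) 0 0 (a24 - a14)"]]])
      (use assms in \<open>simp_all add: lookup_expo_eq_0_iff\<close>)
  have c13: "converging R \<rho>1 \<rho>3"
    using mem unfolding defs by (rule_tac converging_coprime) (simp_all add: lookup_expo_eq_0_iff)
  have c26: "converging R \<rho>2 \<rho>6"
    using mem unfolding defs by (rule_tac converging_coprime) (simp_all add: lookup_expo_eq_0_iff)
  have c34: "converging R \<rho>3 \<rho>4"
    using mem unfolding defs by (rule_tac converging_coprime) (simp_all add: lookup_expo_eq_0_iff)
  have c36: "converging R \<rho>3 \<rho>6"
    using mem unfolding defs by (rule_tac converging_coprime) (simp_all add: lookup_expo_eq_0_iff)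
  have c45: "converging R \<rho>4 \<rho>5"
    using mem unfolding defs by (rule_tac converging_coprime) (simp_all add: lookup_expo_eq_0_iff)
  have c46: "converging R \<rho>4 \<rho>6"
    using mem unfolding defs by (rule_tac converging_coprime) (simp_all add: lookup_expo_eq_0_iff)
  show ?thesis
    unfolding R_def[symmetric]
  proof (rule locally_confluentI)
    show "converging R p q" if "p \<in> R" "q \<in> R" for p q
      using that c12 c14 c15 c16 c23 c24 c25 c35 c56 c13 c26 c34 c36 c45 c46
      unfolding R by (auto intro: converging_refl converging_sym)
  qed
qed

section \<open>Exponents of the generators\<close>

text \<open>The monomials other than \<open>x_j ^ k\<close> with \<open>k < a\<close> span a
  monomial ideal. It contains the generators, hence \<open>I(C)\<close>, and so every pure power of
  \<open>x_j\<close> that is a term of an element of \<open>I(C)\<close> has exponent at least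
  \<open>a\<close>.\<close>

lemma pure_power_exponent_le:
  fixes F :: "'k::field mpoly4 set"
  assumes gen: "curve_ideal n \<subseteq> Idl\<^bsub>mpoly4_ring\<^esub> F"
    and F: "\<And>f m. f \<in> F \<Longrightarrow> m \<in> Poly_Mapping.keys f \<Longrightarrow>
      a \<le> Poly_Mapping.lookup m j \<or> (\<exists>i. i \<noteq> j \<and> 0 < Poly_Mapping.lookup m i)"
    and weight: "weight n p = weight n m" "p \<noteq> m"
    and p: "\<And>i. i \<noteq> j \<Longrightarrow> Poly_Mapping.lookup p i = 0"
  shows "a \<le> Poly_Mapping.lookup p j"
proof -
  let ?U = "{m. a \<le> Poly_Mapping.lookup m j \<or> (\<exists>i. i \<noteq> j \<and> 0 < Poly_Mapping.lookup m i)}"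
  let ?f = "Poly_Mapping.single p 1 - Poly_Mapping.single m 1 :: 'k mpoly4"
  have "ideal {f :: 'k mpoly4. Poly_Mapping.keys f \<subseteq> ?U} mpoly4_ring"
    by (rule ideal_keys_subset) (auto simp: lookup_add)
  then have "Idl\<^bsub>mpoly4_ring\<^esub> F \<subseteq> {f. Poly_Mapping.keys f \<subseteq> ?U}"
    by (rule Idl_mpoly4_least) (use F in blast)
  moreover have "?f \<in> curve_ideal n"
    using weight(1) by (simp add: monomial_diff_in_curve_ideal_iff)
  moreover have "p \<in> Poly_Mapping.keys ?f"
    using weight(2) by (simp add: in_keys_iff lookup_minus lookup_single when_def)
  ultimately have "p \<in> ?U" using gen by blast
  then show ?thesis using p by auto
qed

lemma keys_monomial_diff:
  "Poly_Mapping.keys (Poly_Mapping.single l 1 - Poly_Mapping.single r 1 :: 'a \<Rightarrow>\<^sub>0 'k::ring_1) \<subseteq> {l, r}"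
  by (auto simp: in_keys_iff lookup_minus lookup_single when_def split: if_splits)

lemma ideal_generated_by_relations:
  assumes gen: "minimally_generates mpoly4_ring fs (curve_ideal n :: 'k::field mpoly4 set)"
    and fs: "fs = map (\<lambda>(l, r). Poly_Mapping.single l 1 - Poly_Mapping.single r 1) rs"
  shows "(curve_ideal n :: 'k mpoly4 set) =
      Idl\<^bsub>mpoly4_ring\<^esub> ((\<lambda>(l, r). Poly_Mapping.single l 1 - Poly_Mapping.single r 1) ` set rs)"
    and "\<And>l r. (l, r) \<in> set rs \<Longrightarrow> weight n l = weight n r"
proof -
  let ?B = "(\<lambda>(l, r). Poly_Mapping.single l 1 - Poly_Mapping.single r 1) ` set rs :: 'k mpoly4 set"
  have "set fs = ?B" unfolding fs by simp
  then show eq: "curve_ideal n = Idl\<^bsub>mpoly4_ring\<^esub> ?B"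
    using gen unfolding minimally_generates_def by simp
  show "weight n l = weight n r" if "(l, r) \<in> set rs" for l r
  proof -
    have "(Poly_Mapping.single l 1 - Poly_Mapping.single r 1 :: 'k mpoly4) \<in> ?B"
      using that by force
    then show ?thesis
      using Idl_mpoly4_superset[of ?B] eq monomial_diff_in_curve_ideal_iff by blast
  qed
qed

text \<open>
  Each \<open>a\<^sub>i\<close> is the least exponent of a pure power of \<open>x\<^sub>i\<close> occurring in \<open>I(C)\<close>, and combining two of
  the given binomials produces such a pure power, whence \<open>a\<^sub>1 \<le> a\<^sub>3\<^sub>1 + a\<^sub>4\<^sub>1\<close> and so on.  The weighted sum
  of these four inequalities is an equality.
\<close>

lemma bresinsky_relations:
  fixes n :: "4 \<Rightarrow> nat"
  assumes pos: "\<And>i. 0 < n i"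
    and a: "0 < a12" "a12 < a2" "0 < a32" "a32 < a2" "0 < a14" "a14 < a4" "0 < a24" "a24 < a4"
      "0 < a23" "a23 < a3" "0 < a43" "a43 < a3" "0 < a31" "a31 < a1" "0 < a41" "a41 < a1"
    and rs: "rs = [(expo a1 0 0 0, expo 0 a12 0 a14), (expo 0 a2 0 0, expo 0 0 a23 a24),
      (expo 0 0 a3 0, expo a31 a32 0 0), (expo 0 0 0 a4, expo a41 0 a43 0),
      (expo a31 0 0 a24, expo 0 a12 a43 0)]"
    and gen: "minimally_generates mpoly4_ring
      (map (\<lambda>(l, r). Poly_Mapping.single l 1 - Poly_Mapping.single r 1) rs)
      (curve_ideal n :: 'k::field mpoly4 set)"
  shows "a1 = a31 + a41 \<and> a2 = a12 + a32 \<and> a3 = a23 + a43 \<and> a4 = a14 + a24"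
proof -
  note eq = ideal_generated_by_relations[OF gen refl]
  have w: "\<forall>(l, r) \<in> set rs. weight n l = weight n r" using eq(2) by auto
  have weights: "a1 * n 1 = a12 * n 2 + a14 * n 4" "a2 * n 2 = a23 * n 3 + a24 * n 4"
    "a3 * n 3 = a31 * n 1 + a32 * n 2" "a4 * n 4 = a41 * n 1 + a43 * n 3"
    "a31 * n 1 + a24 * n 4 = a12 * n 2 + a43 * n 3"
    using w unfolding rs by (simp_all add: weight_expo)
  have least: "a \<le> Poly_Mapping.lookup p j"
    if "\<And>l r. (l, r) \<in> set rs \<Longrightarrow>
        (a \<le> Poly_Mapping.lookup l j \<or> (\<exists>i. i \<noteq> j \<and> 0 < Poly_Mapping.lookup l i)) \<and>
        (a \<le> Poly_Mapping.lookup r j \<or> (\<exists>i. i \<noteq> j \<and> 0 < Poly_Mapping.lookup r i))"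
      and "weight n p = weight n m" "p \<noteq> m" "\<And>i. i \<noteq> j \<Longrightarrow> Poly_Mapping.lookup p i = 0"
    for a j p m
  proof (rule pure_power_exponent_le[OF eq(1)[THEN equalityD1] _ that(2-4)])
    fix f :: "'k mpoly4" and m
    assume f: "f \<in> (\<lambda>(l, r). Poly_Mapping.single l 1 - Poly_Mapping.single r 1) ` set rs"
      and m: "m \<in> Poly_Mapping.keys f"
    from f obtain l r where lr: "(l, r) \<in> set rs"
      "f = Poly_Mapping.single l 1 - Poly_Mapping.single r 1" by auto
    then have "m \<in> {l, r}"
      using m keys_monomial_diff[of l r, where 'k = 'k] by auto
    then have "m = l \<or> m = r" by simp
    then show "a \<le> Poly_Mapping.lookup m j \<or> (\<exists>i. i \<noteq> j \<and> 0 < Poly_Mapping.lookup m i)"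
      using that(1)[OF lr(1)] by blast
  qed
  \<comment> \<open>The witnesses \<open>m\<close> come from combining the weight relation of
    \<open>f5\<close> with that of \<open>f4\<close>, \<open>f3\<close>, \<open>f2\<close> and
    \<open>f1\<close> in turn and cancelling common terms.\<close>
  have "a1 \<le> Poly_Mapping.lookup (expo (a31 + a41) 0 0 0) 1"
  proof (rule least[where m = "expo 0 a12 0 (a4 - a24)"])
    obtain d where "a4 = a24 + d" using a by (metis less_imp_add_positive)
    then show "weight n (expo (a31 + a41) 0 0 0) = weight n (expo 0 a12 0 (a4 - a24))"
      using weights by (simp add: weight_expo algebra_simps)
  qed (use a in \<open>auto simp: rs lookup_expo_eq_0_iff ex_4\<close>)
  moreover have "a2 \<le> Poly_Mapping.lookup (expo 0 (a12 + a32) 0 0) 2"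
  proof (rule least[where m = "expo 0 0 (a3 - a43) a24"])
    obtain d where "a3 = a43 + d" using a by (metis less_imp_add_positive)
    then show "weight n (expo 0 (a12 + a32) 0 0) = weight n (expo 0 0 (a3 - a43) a24)"
      using weights by (simp add: weight_expo algebra_simps)
  qed (use a in \<open>auto simp: rs lookup_expo_eq_0_iff ex_4\<close>)
  moreover have "a3 \<le> Poly_Mapping.lookup (expo 0 0 (a23 + a43) 0) 3"
  proof (rule least[where m = "expo a31 (a2 - a12) 0 0"])
    obtain d where "a2 = a12 + d" using a by (metis less_imp_add_positive)
    then show "weight n (expo 0 0 (a23 + a43) 0) = weight n (expo a31 (a2 - a12) 0 0)"
      using weights by (simp add: weight_expo algebra_simps)
  qed (use a in \<open>auto simp: rs lookup_expo_eq_0_iff ex_4\<close>)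
  moreover have "a4 \<le> Poly_Mapping.lookup (expo 0 0 0 (a14 + a24)) 4"
  proof (rule least[where m = "expo (a1 - a31) 0 a43 0"])
    obtain d where "a1 = a31 + d" using a by (metis less_imp_add_positive)
    then show "weight n (expo 0 0 0 (a14 + a24)) = weight n (expo (a1 - a31) 0 a43 0)"
      using weights by (simp add: weight_expo algebra_simps)
  qed (use a in \<open>auto simp: rs lookup_expo_eq_0_iff ex_4\<close>)
  ultimately have le: "a1 * n 1 \<le> (a31 + a41) * n 1" "a2 * n 2 \<le> (a12 + a32) * n 2"
    "a3 * n 3 \<le> (a23 + a43) * n 3" "a4 * n 4 \<le> (a14 + a24) * n 4"
    by (auto intro: mult_le_mono1)
  have "a1 * n 1 = (a31 + a41) * n 1 \<and> a2 * n 2 = (a12 + a32) * n 2 \<and>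
      a3 * n 3 = (a23 + a43) * n 3 \<and> a4 * n 4 = (a14 + a24) * n 4"
    using weights(1-4) le unfolding add_mult_distrib by linarith
  then show ?thesis
    using pos[of 1] pos[of 2] pos[of 3] pos[of 4] unfolding mult_cancel2 by linarith
qed

section \<open>The minimal generators of the initial ideal\<close>

text \<open>The polynomials all of whose terms are divisible by \<open>x_v\<close> or by some
  \<open>ls ! j\<close> with \<open>j \<noteq> i\<close> form an ideal containing every generator
  except the \<open>i\<close>-th, whose term \<open>ls ! i\<close> has neither property.\<close>

lemma minimally_generates_if_no_divisibility:
  fixes gs :: "'k::field mpoly4 list"
  assumes len: "length ls = length gs"
    and keys: "\<And>i. i < length gs \<Longrightarrow> ls ! i \<in> Poly_Mapping.keys (gs ! i)"
      "\<And>i m. i < length gs \<Longrightarrow> m \<in> Poly_Mapping.keys (gs ! i) \<Longrightarrow>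
        m = ls ! i \<or> 0 < Poly_Mapping.lookup m v"
    and lookup: "\<And>i. i < length gs \<Longrightarrow> Poly_Mapping.lookup (ls ! i) v = 0"
    and div: "\<And>i j. i < length gs \<Longrightarrow> j < length gs \<Longrightarrow> i \<noteq> j \<Longrightarrow> \<not> (\<exists>m. ls ! i = m + ls ! j)"
  shows "minimally_generates mpoly4_ring gs (Idl\<^bsub>mpoly4_ring\<^esub> (set gs))"
proof (rule minimally_generates_mpoly4I[OF refl])
  fix i assume i: "i < length gs"
  let ?U = "{m. 0 < Poly_Mapping.lookup m v \<or> (\<exists>j c. j < length gs \<and> j \<noteq> i \<and> m = c + ls ! j)}"
  let ?T = "{f :: 'k mpoly4. Poly_Mapping.keys f \<subseteq> ?U}"
  have "ideal ?T mpoly4_ring"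
  proof (rule ideal_keys_subset)
    fix c m assume "m \<in> ?U"
    then consider "0 < Poly_Mapping.lookup m v"
      | j d where "j < length gs" "j \<noteq> i" "m = d + ls ! j" by auto
    then show "c + m \<in> ?U"
    proof cases
      case 1
      then show ?thesis by (simp add: lookup_add)
    next
      case 2
      then have "c + m = (c + d) + ls ! j" by (simp add: add.assoc)
      then show ?thesis using 2(1,2) unfolding mem_Collect_eq by metis
    qed
  qed
  moreover have "ls ! i \<notin> ?U"
    using lookup[OF i] div[OF i] unfolding mem_Collect_eq by (metis less_irrefl)
  then have "gs ! i \<notin> ?T"
    using keys(1)[OF i] by blast
  moreover have "gs ! j \<in> ?T" if j: "j < length gs" "j \<noteq> i" for j
  proof -
    have "ls ! j = 0 + ls ! j" by simp
    then have "ls ! j \<in> ?U" using j unfolding mem_Collect_eq by metis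
    then show ?thesis using keys(2)[OF j(1)] by (auto simp del: add_0)
  qed
  ultimately show "\<exists>T. ideal T mpoly4_ring \<and> gs ! i \<notin> T \<and>
      (\<forall>j < length gs. j \<noteq> i \<longrightarrow> gs ! j \<in> T)"
    by (intro exI[of _ ?T]) simp
qed

text \<open>The sign matters because the rules orient \<open>f1\<close>, \<open>f2\<close> and
  \<open>f5\<close> opposite to the given binomials.\<close>

lemma Idl_mpoly4_subset_up_to_sign:
  fixes A B :: "'k::field mpoly4 set"
  assumes "\<And>f. f \<in> A \<Longrightarrow> f \<in> B \<or> - f \<in> B"
  shows "Idl\<^bsub>mpoly4_ring\<^esub> A \<subseteq> Idl\<^bsub>mpoly4_ring\<^esub> B"
proof (rule Idl_mpoly4_least[OF ideal_Idl_mpoly4])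
  show "A \<subseteq> Idl\<^bsub>mpoly4_ring\<^esub> B"
    using assms Idl_mpoly4_superset[of B] ideal_uminus_iff[OF ideal_Idl_mpoly4, of _ B] by blast
qed

text \<open>Lowering \<open>q\<close> and \<open>r\<close> to \<open>p\<close> shrinks the
  right-hand side. It applies to \<open>f1\<close> and \<open>f2\<close>, whose pure power is in the
  lightest variable involved.\<close>

lemma degree_less_if_weight_eq:
  fixes b c p q r d :: nat
  assumes "d * p = b * q + c * r" "p < q" "p < r" "0 < b" "0 < c"
  shows "b + c < d"
proof -
  have "b * p < b * q" "c * p < c * r" using assms by auto
  then have "(b + c) * p < d * p" unfolding add_mult_distrib assms(1) by linarith
  then show ?thesis by simp
qed

text \<open>The mirror image, for \<open>f3\<close> and \<open>f4\<close>, whose pure power is in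
  the heaviest variable involved.\<close>

lemma less_degree_if_weight_eq:
  fixes b c p q r d :: nat
  assumes "d * p = b * q + c * r" "q < p" "r < p" "0 < b" "0 < c"
  shows "d < b + c"
proof -
  have "b * q < b * p" "c * r < c * p" using assms by auto
  then have "d * p < (b + c) * p" unfolding add_mult_distrib assms(1) by linarith
  then show ?thesis by simp
qed

theorem theorem2p23:
  fixes n :: "4 \<Rightarrow> nat"
    and a1 a2 a3 a4 a12 a14 a23 a24 a31 a32 a41 a43 :: nat
    and f1 f2 f3 f4 f5 p5 p6 :: "'k::field mpoly4"
  assumes "0 < n 1" "n 1 < n 2" "n 2 < n 3" "n 3 < n 4"
    and "Gcd {n 1, n 2, n 3, n 4} = 1"
    and "gorenstein_curve n"
    and "\<not> complete_intersection_curve TYPE('k) n"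
    and "cohen_macaulay_tangent_cone TYPE('k) n"
    and "1 < a1" "1 < a2" "1 < a3" "1 < a4"
    and "0 < a12" "a12 < a2" "0 < a32" "a32 < a2"
    and "0 < a14" "a14 < a4" "0 < a24" "a24 < a4"
    and "0 < a23" "a23 < a3" "0 < a43" "a43 < a3"
    and "0 < a31" "a31 < a1" "0 < a41" "a41 < a1"
    and "f1 = X 1 ^ a1 - X 2 ^ a12 * X 4 ^ a14"
    and "f2 = X 2 ^ a2 - X 3 ^ a23 * X 4 ^ a24"
    and "f3 = X 3 ^ a3 - X 1 ^ a31 * X 2 ^ a32"
    and "f4 = X 4 ^ a4 - X 1 ^ a41 * X 3 ^ a43"
    and "f5 = X 1 ^ a31 * X 4 ^ a24 - X 2 ^ a12 * X 3 ^ a43"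
    and "minimally_generates mpoly4_ring [f1, f2, f3, f4, f5] (curve_ideal n)"
    and "a23 < a43" "a14 \<le> a24"
    and "a3 \<le> a31 + a32"
    and "a12 + a43 \<le> a31 + a24"
    and "a2 + a12 \<le> a1 + a23 + a24 - a14"
    and "p5 = (if a12 + a43 < a31 + a24
               then X 2 ^ a12 * X 3 ^ a43
               else X 1 ^ a31 * X 4 ^ a24 - X 2 ^ a12 * X 3 ^ a43)"
    and "p6 = (if a2 + a12 < a1 + a23 + a24 - a14
               then X 2 ^ (a2 + a12)
               else X 2 ^ (a2 + a12) - X 1 ^ a1 * X 3 ^ a23 * X 4 ^ (a24 - a14))"
  shows "minimally_generates mpoly4_ring
           [X 2 ^ a12 * X 4 ^ a14, X 3 ^ a23 * X 4 ^ a24, X 3 ^ a3, X 4 ^ a4, p5, p6]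
           (initial_ideal (curve_ideal n))"
proof -
  note pos = assms(1-4) and bounds = assms(13-28) and fdefs = assms(29-33) and gen = assms(34)
  note tail = assms(35-39) and pdefs = assms(40,41)
  have n_pos: "0 < n i" for i
    using exhaust_4[of i] pos by auto
  define rs where "rs = [(expo a1 0 0 0, expo 0 a12 0 a14), (expo 0 a2 0 0, expo 0 0 a23 a24),
      (expo 0 0 a3 0, expo a31 a32 0 0), (expo 0 0 0 a4, expo a41 0 a43 0),
      (expo a31 0 0 a24, expo 0 a12 a43 0)]"
  have fs: "[f1, f2, f3, f4, f5] = map (\<lambda>(l, r). Poly_Mapping.single l 1 - Poly_Mapping.single r 1) rs"
    unfolding fdefs rs_def by (simp add: X_power expo_def mult_single)
  have a: "a1 = a31 + a41 \<and> a2 = a12 + a32 \<and> a3 = a23 + a43 \<and> a4 = a14 + a24"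
    by (rule bresinsky_relations[OF n_pos bounds rs_def gen[unfolded fs]])
  note eq = ideal_generated_by_relations[OF gen fs]
  have w: "\<forall>(l, r) \<in> set rs. weight n l = weight n r" using eq(2) by auto
  have weights: "a1 * n 1 = a12 * n 2 + a14 * n 4" "a2 * n 2 = a23 * n 3 + a24 * n 4"
    "a3 * n 3 = a31 * n 1 + a32 * n 2" "a4 * n 4 = a41 * n 1 + a43 * n 3"
    "a31 * n 1 + a24 * n 4 = a12 * n 2 + a43 * n 3"
    using w unfolding rs_def by (simp_all add: weight_expo)
  have degrees: "a12 + a14 < a1" "a23 + a24 < a2" "a3 < a31 + a32" "a4 < a41 + a43"
    using degree_less_if_weight_eq[OF weights(1)] degree_less_if_weight_eq[OF weights(2)]
      less_degree_if_weight_eq[OF weights(3)] less_degree_if_weight_eq[OF weights(4)] pos bounds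
    by simp_all
  define R where "R = standard_rules a12 a14 a23 a24 a31 a32 a41 a43"
  have R: "R = {(expo 0 a12 0 a14, expo a1 0 0 0), (expo 0 0 a23 a24, expo 0 a2 0 0),
     (expo 0 0 a3 0, expo a31 a32 0 0), (expo 0 0 0 a4, expo a41 0 a43 0),
     (expo 0 a12 a43 0, expo a31 0 0 a24), (expo 0 (a2 + a12) 0 0, expo a1 0 a23 (a24 - a14))}"
    using a by (simp add: R_def standard_rules_def)
  \<comment> \<open>The weight relations of \<open>f1\<close> and \<open>f2\<close> are added and
    \<open>a14 * n 4\<close> is cancelled against part of \<open>a24 * n 4\<close>.\<close>
  have weight6: "(a2 + a12) * n 2 = a1 * n 1 + a23 * n 3 + (a24 - a14) * n 4"
  proof -
    obtain e where "a24 = a14 + e" using tail(2) by (metis le_Suc_ex)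
    then show ?thesis using weights(1,2) by (simp add: algebra_simps)
  qed
  interpret curve_rewriting n R
  proof
    show "0 < n i" for i by (rule n_pos)
    show "locally_confluent R"
      unfolding R_def using tail(1,2) by (intro locally_confluent_standard_rules) simp_all
    show "weight n l = weight n r" if "(l, r) \<in> R" for l r
      using that weights weight6 unfolding R by (auto simp: weight_expo)
    \<comment> \<open>Only the last two rules can tie in degree; there the left side is free of
      \<open>x_1\<close> while the right side is not.\<close>
    show "total_degree l < total_degree r \<or>
        total_degree l = total_degree r \<and> Poly_Mapping.lookup l 1 < Poly_Mapping.lookup r 1"
      if "(l, r) \<in> R" for l r
      using that degrees tail bounds unfolding R by (auto simp: total_degree_expo)
  qed
  have "(curve_ideal n :: 'k mpoly4 set) \<subseteq>
      Idl\<^bsub>mpoly4_ring\<^esub> ((\<lambda>(l, r). Poly_Mapping.single l 1 - Poly_Mapping.single r 1) ` R)"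
    unfolding eq(1)
  proof (rule Idl_mpoly4_subset_up_to_sign)
    show "f \<in> (\<lambda>(l, r). Poly_Mapping.single l 1 - Poly_Mapping.single r 1) ` R \<or>
        - f \<in> (\<lambda>(l, r). Poly_Mapping.single l 1 - Poly_Mapping.single r 1) ` R"
      if "f \<in> (\<lambda>(l, r). Poly_Mapping.single l 1 - Poly_Mapping.single r 1) ` set rs" for f :: "'k mpoly4"
      using that unfolding rs_def R by auto
  qed
  note initial = initial_ideal_eq[OF this]
  define gs :: "'k mpoly4 list" where
    "gs = [X 2 ^ a12 * X 4 ^ a14, X 3 ^ a23 * X 4 ^ a24, X 3 ^ a3, X 4 ^ a4, p5, p6]"
  \<comment> \<open>The left-hand sides of the rules: in each generator, the one term free of
    \<open>x_1\<close>.\<close>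
  define ls where
    "ls = [expo 0 a12 0 a14, expo 0 0 a23 a24, expo 0 0 a3 0, expo 0 0 0 a4, expo 0 a12 a43 0,
      expo 0 (a2 + a12) 0 0]"
  have p5: "p5 = (if a12 + a43 < a31 + a24 then Poly_Mapping.single (expo 0 a12 a43 0) 1
      else Poly_Mapping.single (expo a31 0 0 a24) 1 - Poly_Mapping.single (expo 0 a12 a43 0) 1)"
    unfolding pdefs by (simp add: X_power expo_def mult_single)
  have p6: "p6 = (if a2 + a12 < a1 + a23 + a24 - a14 then Poly_Mapping.single (expo 0 (a2 + a12) 0 0) 1
      else Poly_Mapping.single (expo 0 (a2 + a12) 0 0) 1 -
        Poly_Mapping.single (expo a1 0 a23 (a24 - a14)) 1)"
    unfolding pdefs by (simp add: X_power expo_def mult_single)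
  have gs: "gs = [Poly_Mapping.single (expo 0 a12 0 a14) 1, Poly_Mapping.single (expo 0 0 a23 a24) 1,
      Poly_Mapping.single (expo 0 0 a3 0) 1, Poly_Mapping.single (expo 0 0 0 a4) 1, p5, p6]"
    unfolding gs_def by (simp add: X_power expo_def mult_single)
  \<comment> \<open>In the tie case the fifth rule is oriented opposite to \<open>p5\<close>, which
    accounts for the sign.\<close>
  have "rule_initial_form ` R = {Poly_Mapping.single (expo 0 a12 0 a14) 1,
      Poly_Mapping.single (expo 0 0 a23 a24) 1, Poly_Mapping.single (expo 0 0 a3 0) 1,
      Poly_Mapping.single (expo 0 0 0 a4) 1,
      if a12 + a43 < a31 + a24 then p5 else - p5, p6}"
    using degrees tail(2) unfolding R p5 p6 by (simp add: rule_initial_form_def total_degree_expo)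
  then have "Idl\<^bsub>mpoly4_ring\<^esub> (set gs) = Idl\<^bsub>mpoly4_ring\<^esub> (rule_initial_form ` R)"
    unfolding gs by (intro equalityI Idl_mpoly4_subset_up_to_sign) auto
  moreover have "minimally_generates mpoly4_ring gs (Idl\<^bsub>mpoly4_ring\<^esub> (set gs))"
  proof (rule minimally_generates_if_no_divisibility[where ls = ls and v = 1])
    have six: "i = 0 \<or> i = 1 \<or> i = 2 \<or> i = 3 \<or> i = 4 \<or> i = 5" if "i < length gs" for i
      using that unfolding gs by auto
    show "length ls = length gs" by (simp add: ls_def gs)
    show "ls ! i \<in> Poly_Mapping.keys (gs ! i)" if "i < length gs" for i
      using six[OF that] bounds unfolding ls_def gs p5 p6
      by (elim disjE) (simp_all add: in_keys_iff lookup_minus lookup_single when_def)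
    show "m = ls ! i \<or> 0 < Poly_Mapping.lookup m 1"
      if "i < length gs" "m \<in> Poly_Mapping.keys (gs ! i)" for i m
      using six[OF that(1)] that(2) bounds unfolding ls_def gs p5 p6
      by (elim disjE)
        (auto split: if_splits dest!: keys_monomial_diff[THEN subsetD])
    show "Poly_Mapping.lookup (ls ! i) 1 = 0" if "i < length gs" for i
      using six[OF that] unfolding ls_def by (elim disjE) simp_all
    \<comment> \<open>The three mixed monomials use three different pairs of variables, and each of
      their exponents is smaller than that of the pure power in the same variable.\<close>
    show "\<not> (\<exists>m. ls ! i = m + ls ! j)" if "i < length gs" "j < length gs" "i \<noteq> j" for i j
      using six[OF that(1)] six[OF that(2)] that(3) bounds unfolding ls_def
      by (elim disjE) (simp_all add: expo_divides_iff)
  qed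
  ultimately show ?thesis
    unfolding initial gs_def by simp
qed

end
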